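(* Let $\mathcal{H}_A$ be a complex Hilbert space of finite dimension $d_A\ge 2$. Then the inequality $$N_{A:CB}\le N_{AC:B}+N_{AB:C}$$ holds for every pure state $|\psi\rangle\langle\psi|$ on $\mathcal{H}_A\otimes\mathcal{H}_B\otimes\mathcal{H}_C$, for all finite-dimensional complex Hilbert spaces $\mathcal{H}_B,\mathcal{H}_C$, if and only if $d_A=2$ (i.e. subsystem $A$ is a qubit).
   Context: For a bipartite state $\rho_{XY}$ on $\mathcal{H}_X\otimes\mathcal{H}_Y$, the negativity is $N_{X:Y}=\frac{\|\rho_{XY}^{T_X}\|_1-1}{2}$, where $\rho_{XY}^{T_X}$ is the partial transpose with respect to subsystem $X$ and $\|\sigma\|_1=\mathrm{Tr}\sqrt{\sigma^\dagger\sigma}$ is the trace norm. For a tripartite state, $N_{A:CB}$, $N_{AC:B}$, $N_{AB:C}$ denote the negativities of the state with respect to the bipartitions $A|BC$, $AC|B$ and $AB|C$ respectively. *)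

theory Defs
  imports Complex_Main "Jordan_Normal_Form.Schur_Decomposition"
begin

definition psd_mat :: "complex mat \<Rightarrow> bool" where
  "psd_mat M \<longleftrightarrow> M \<in> carrier_mat (dim_row M) (dim_row M) \<and> mat_adjoint M = M \<and>
     (\<forall>v \<in> carrier_vec (dim_row M). 0 \<le> Re (conjugate v \<bullet> (M *\<^sub>v v)))"

definition mat_sqrt :: "complex mat \<Rightarrow> complex mat" where
  "mat_sqrt M = (THE S. psd_mat S \<and> S * S = M)"

definition mat_trace :: "complex mat \<Rightarrow> complex" where
  "mat_trace M = (\<Sum>i<dim_row M. M $$ (i, i))"

definition trace_norm :: "complex mat \<Rightarrow> real" where
  "trace_norm S = Re (mat_trace (mat_sqrt (mat_adjoint S * S)))"

text \<open>Partial transpose w.r.t. the first factor X of H_X (x) H_Y, with the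
  product basis index (x,y) encoded as x * dY + y.\<close>
definition partial_transpose1 :: "nat \<Rightarrow> nat \<Rightarrow> complex mat \<Rightarrow> complex mat" where
  "partial_transpose1 dX dY \<rho> = mat (dX * dY) (dX * dY)
     (\<lambda>(i, j). \<rho> $$ ((j div dY) * dY + i mod dY, (i div dY) * dY + j mod dY))"

definition negativity :: "nat \<Rightarrow> nat \<Rightarrow> complex mat \<Rightarrow> real" where
  "negativity dX dY \<rho> = (trace_norm (partial_transpose1 dX dY \<rho>) - 1) / 2"

definition ket_bra :: "complex vec \<Rightarrow> complex mat" where
  "ket_bra v = mat (dim_vec v) (dim_vec v) (\<lambda>(i, j). v $ i * cnj (v $ j))"

definition unit_vec_c :: "complex vec \<Rightarrow> bool" where
  "unit_vec_c v \<longleftrightarrow> (\<Sum>i<dim_vec v. (cmod (v $ i))\<^sup>2) = 1"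

text \<open>A tripartite vector psi in H_A (x) H_B (x) H_C is stored with index
  (a * dB + b) * dC + c. Its amplitude:\<close>
definition amp :: "nat \<Rightarrow> nat \<Rightarrow> complex vec \<Rightarrow> nat \<Rightarrow> nat \<Rightarrow> nat \<Rightarrow> complex" where
  "amp dB dC \<psi> a b c = \<psi> $ ((a * dB + b) * dC + c)"

text \<open>The same vector written in H_A (x) H_C (x) H_B, index (a * dC + c) * dB + b.\<close>
definition reorder_ACB :: "nat \<Rightarrow> nat \<Rightarrow> nat \<Rightarrow> complex vec \<Rightarrow> complex vec" where
  "reorder_ACB dA dB dC \<psi> = vec (dA * dC * dB)
     (\<lambda>i. amp dB dC \<psi> (i div (dC * dB)) (i mod dB) ((i div dB) mod dC))"

definition neg_A_CB :: "nat \<Rightarrow> nat \<Rightarrow> nat \<Rightarrow> complex vec \<Rightarrow> real" where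
  "neg_A_CB dA dB dC \<psi> = negativity dA (dC * dB) (ket_bra (reorder_ACB dA dB dC \<psi>))"

definition neg_AC_B :: "nat \<Rightarrow> nat \<Rightarrow> nat \<Rightarrow> complex vec \<Rightarrow> real" where
  "neg_AC_B dA dB dC \<psi> = negativity (dA * dC) dB (ket_bra (reorder_ACB dA dB dC \<psi>))"

definition neg_AB_C :: "nat \<Rightarrow> nat \<Rightarrow> nat \<Rightarrow> complex vec \<Rightarrow> real" where
  "neg_AB_C dA dB dC \<psi> = negativity (dA * dB) dC (ket_bra \<psi>)"

end

theory Submission
  imports Defs
begin

text \<open>A pure bipartite state with Schmidt coefficients s has (\<Sum>s)^2 as the trace norm of its partial
  transpose. Since (\<Sum>s^2) = 1, twice the negativity is E = \<Sum>i\<noteq>j. s i s j, and E is at least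
  C = sqrt (2 (1 - P)) with P = \<Sum>s^4 the purity of the reduced states; equality holds when there are
  at most two Schmidt coefficients, in particular for the cut at a qubit. Linear entropy 1 - P is
  subadditive, so C(A)^2 \<le> C(B)^2 + C(C)^2 and hence C(A) \<le> C(B) + C(C). For dimension at least 3
  a three-term state of a qutrit and two qubits violates the inequality.\<close>

section \<open>Uniqueness of positive semidefinite square roots\<close>

text \<open>\<open>mat_sqrt\<close> is a definite description, so no trace norm can be evaluated
  before positive semidefinite roots are known to be unique; their existence is then read off from a
  singular value form. The estimate E \<ge> C points the right way for the cuts at B and C in every
  dimension. The cut at A stands on the smaller side and needs E bounded above by C, and this is
  where A has to be a qubit. The counterexample exploits that a cut at a qubit has negativity at
  most 1/2 while a qutrit can reach 1. A qutrit maximally entangled with three of the four product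
  basis states of two qubits leaves each qubit with the unequal weights 1/3 and 2/3, so both qubit
  cuts stay strictly below 1/2.\<close>

lemma dim_mat_adjoint [simp]:
  "dim_row (mat_adjoint A) = dim_col A" "dim_col (mat_adjoint A) = dim_row A"
  by (simp_all add: mat_adjoint_def)

lemma index_mat_adjoint [simp]:
  fixes A :: "complex mat"
  assumes "i < dim_col A" "j < dim_row A"
  shows "mat_adjoint A $$ (i, j) = cnj (A $$ (j, i))"
  using assms by (simp add: mat_adjoint_def mat_of_rows_def col_def)

lemma mat_trace_mult_commute:
  assumes "A \<in> carrier_mat n m" "B \<in> carrier_mat m n"
  shows "mat_trace (A * B) = mat_trace (B * A)"
proof -
  have "mat_trace (A * B) = (\<Sum>i<n. \<Sum>j<m. A $$ (i, j) * B $$ (j, i))"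
    using assms by (simp add: mat_trace_def scalar_prod_def atLeast0LessThan)
  also have "\<dots> = (\<Sum>j<m. \<Sum>i<n. B $$ (j, i) * A $$ (i, j))"
    by (subst sum.swap) (simp add: mult.commute)
  also have "\<dots> = mat_trace (B * A)"
    using assms by (simp add: mat_trace_def scalar_prod_def atLeast0LessThan)
  finally show ?thesis .
qed

lemma hermitian_form_conjugate:
  assumes "S \<in> carrier_mat n n" "mat_adjoint S = S" "v \<in> carrier_vec n" "w \<in> carrier_vec n"
  shows "conjugate v \<bullet> (S *\<^sub>v w) = cnj (conjugate w \<bullet> (S *\<^sub>v v))"
proof -
  have S: "cnj (S $$ (j, i)) = S $$ (i, j)" if "i < n" "j < n" for i j
    using that assms(1) index_mat_adjoint[of i S j] by (simp add: assms(2))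
  have "conjugate v \<bullet> (S *\<^sub>v w) = (\<Sum>i<n. \<Sum>j<n. cnj (v $ i) * (S $$ (i, j) * w $ j))"
    using assms by (simp add: scalar_prod_def atLeast0LessThan sum_distrib_left)
  also have "\<dots> = (\<Sum>j<n. \<Sum>i<n. w $ j * (cnj (S $$ (j, i)) * cnj (v $ i)))"
    by (subst sum.swap) (intro sum.cong refl, simp add: S algebra_simps)
  also have "\<dots> = cnj (conjugate w \<bullet> (S *\<^sub>v v))"
    using assms by (simp add: scalar_prod_def atLeast0LessThan sum_distrib_left)
  finally show ?thesis .
qed

text \<open>Perturbation in the direction w = S d: the form at d + e w equals 2 e N + e^2 c with N
  the squared norm of w. The linear term would make it negative for small negative e unless N =
  0.\<close>

lemma psd_form_zero_imp_kernel:
  assumes S: "S \<in> carrier_mat n n" and psd: "psd_mat S" and d: "d \<in> carrier_vec n"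
    and zero: "Re (conjugate d \<bullet> (S *\<^sub>v d)) = 0"
  shows "S *\<^sub>v d = 0\<^sub>v n"
proof -
  define w where "w = S *\<^sub>v d"
  have w: "w \<in> carrier_vec n" using S d by (simp add: w_def)
  have adj: "mat_adjoint S = S"
    and pos: "\<And>v. v \<in> carrier_vec n \<Longrightarrow> 0 \<le> Re (conjugate v \<bullet> (S *\<^sub>v v))"
    using psd S unfolding psd_mat_def by auto
  define c N where "c = Re (conjugate w \<bullet> (S *\<^sub>v w))" and "N = Re (conjugate w \<bullet> w)"
  have c: "c \<ge> 0" unfolding c_def by (rule pos[OF w])
  have quad: "0 \<le> 2 * e * N + e\<^sup>2 * c" for e :: real
  proof -
    define v where "v = d + complex_of_real e \<cdot>\<^sub>v w"
    have v: "v \<in> carrier_vec n" using d w by (simp add: v_def)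
    have Sv: "S *\<^sub>v v = w + complex_of_real e \<cdot>\<^sub>v (S *\<^sub>v w)"
      using S d w by (simp add: v_def mult_add_distrib_mat_vec[OF S] mult_mat_vec[OF S] w_def)
    have cv: "conjugate v = conjugate d + complex_of_real e \<cdot>\<^sub>v conjugate w"
      using d w by (simp add: v_def conjugate_add_vec[of _ n] conjugate_smult_vec)
    have Sw: "S *\<^sub>v w \<in> carrier_vec n" using S w by simp
    have "conjugate v \<bullet> (S *\<^sub>v v) = conjugate d \<bullet> w + complex_of_real e * (conjugate d \<bullet> (S *\<^sub>v w))
        + complex_of_real e * (conjugate w \<bullet> w) + (complex_of_real e)\<^sup>2 * (conjugate w \<bullet> (S *\<^sub>v w))"
      unfolding Sv cv using d w Sw
      by (simp add: add_scalar_prod_distrib[of _ n] scalar_prod_add_distrib[of _ n]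
          scalar_prod_smult_distrib[of _ n] smult_scalar_prod_distrib[of _ n]
          algebra_simps power2_eq_square)
    moreover have "conjugate d \<bullet> (S *\<^sub>v w) = cnj (conjugate w \<bullet> w)"
      using hermitian_form_conjugate[OF S adj d w] by (simp add: w_def)
    ultimately have "Re (conjugate v \<bullet> (S *\<^sub>v v)) = 2 * e * N + e\<^sup>2 * c"
      using zero by (simp add: w_def[symmetric] N_def c_def flip: of_real_power)
    then show ?thesis using pos[OF v] by simp
  qed
  have Nsum: "N = (\<Sum>i<n. (cmod (w $ i))\<^sup>2)"
    using w by (simp add: N_def scalar_prod_def atLeast0LessThan mult.commute[of "cnj _"]
        complex_norm_square[symmetric] del: of_real_power)
  have "N \<le> 0"
  proof (rule ccontr)
    assume "\<not> N \<le> 0"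
    then have "N > 0" by simp
    \<comment> \<open>The minimizer would be e = - N / c; the denominator c + 1 also covers c = 0
      and still gives a negative value.\<close>
    have "2 * (- N / (c + 1)) * N + (- N / (c + 1))\<^sup>2 * c = - (N\<^sup>2 * (c + 2)) / (c + 1)\<^sup>2"
      using c by (simp add: divide_simps power2_eq_square) (simp add: algebra_simps)
    moreover have "N\<^sup>2 * (c + 2) / (c + 1)\<^sup>2 > 0" using c \<open>N > 0\<close> by simp
    ultimately show False using quad[of "- N / (c + 1)"] by simp
  qed
  then have "(\<Sum>i<n. (cmod (w $ i))\<^sup>2) = 0" using Nsum by (simp add: antisym sum_nonneg)
  then have "w $ i = 0" if "i < n" for i using that by (subst (asm) sum_nonneg_eq_0_iff) auto
  then show ?thesis unfolding w_def[symmetric] using w by (intro eq_vecI) auto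
qed

text \<open>With D = S - T one has S D + D T = 0, so the traces of D S D and D T D are nonnegative and
  add up to 0. Hence S D = T D = 0, and D D = 0.\<close>
lemma psd_sqrt_unique:
  assumes S: "S \<in> carrier_mat n n" "psd_mat S" and T: "T \<in> carrier_mat n n" "psd_mat T"
    and eq: "S * S = T * T"
  shows "S = T"
proof -
  define D where "D = S - T"
  have D: "D \<in> carrier_mat n n" using S T by (auto simp: D_def)
  have adj: "mat_adjoint S = S" "mat_adjoint T = T" using S T unfolding psd_mat_def by auto
  have herm: "D $$ (i, j) = cnj (D $$ (j, i))" if "i < n" "j < n" for i j
    using that S T index_mat_adjoint[of i S j] index_mat_adjoint[of i T j]
    by (simp add: D_def adj)
  \<comment> \<open>Since D is Hermitian, its rows are its conjugated columns, so the trace splits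
    into values of the form of R at the columns of D.\<close>
  have tr: "mat_trace (D * (R * D)) = (\<Sum>j<n. conjugate (col D j) \<bullet> (R *\<^sub>v col D j))"
    if R: "R \<in> carrier_mat n n" for R
    unfolding mat_trace_def
  proof (intro sum.cong)
    fix j assume "j \<in> {..<n}"
    then have j: "j < n" by simp
    have "row D j = conjugate (col D j)" using D j by (intro eq_vecI) (auto simp: herm[of j])
    then show "(D * (R * D)) $$ (j, j) = conjugate (col D j) \<bullet> (R *\<^sub>v col D j)"
      using D R j by (simp add: mult_mat_vec_def)
  qed (use D in auto)
  have kernel: "R * D = 0\<^sub>m n n" if R: "R \<in> carrier_mat n n" "psd_mat R"
    and z: "Re (mat_trace (D * (R * D))) = 0" for R
  proof -
    have "(\<Sum>j<n. Re (conjugate (col D j) \<bullet> (R *\<^sub>v col D j))) = 0"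
      using z by (simp add: tr[OF R(1)])
    moreover have "0 \<le> Re (conjugate (col D j) \<bullet> (R *\<^sub>v col D j))" if "j < n" for j
      using R D that unfolding psd_mat_def by auto
    ultimately have "Re (conjugate (col D j) \<bullet> (R *\<^sub>v col D j)) = 0" if "j < n" for j
      using that by (subst (asm) sum_nonneg_eq_0_iff) auto
    then have col: "R *\<^sub>v col D j = 0\<^sub>v n" if "j < n" for j
      using that psd_form_zero_imp_kernel[OF R] D by simp
    show ?thesis
    proof (rule eq_matI)
      fix i j assume ij: "i < dim_row (0\<^sub>m n n :: complex mat)" "j < dim_col (0\<^sub>m n n :: complex mat)"
      then have "(R * D) $$ (i, j) = (R *\<^sub>v col D j) $ i" using R D by simp
      then show "(R * D) $$ (i, j) = 0\<^sub>m n n $$ (i, j)" using col ij by simp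
    qed (use R D in auto)
  qed
  have nonneg: "0 \<le> Re (mat_trace (D * (R * D)))" if R: "R \<in> carrier_mat n n" "psd_mat R" for R
    using R D by (auto simp: tr psd_mat_def intro!: sum_nonneg)
  have "S * D = S * S - S * T" "D * T = S * T - T * T"
    using S T by (auto simp: D_def mult_minus_distrib_mat minus_mult_distrib_mat)
  then have "S * D = - (D * T)" using S T eq by (intro eq_matI) auto
  then have "D * (S * D) = - (D * (D * T))" using D T by simp
  then have "mat_trace (D * (S * D)) = - mat_trace (D * (D * T))"
    using D T by (simp add: mat_trace_def sum_negf)
  also have "mat_trace (D * (D * T)) = mat_trace (D * (T * D))"
    using D T mat_trace_mult_commute[of D n n "D * T"] by (simp add: assoc_mult_mat[OF D])
  finally have "Re (mat_trace (D * (S * D))) = - Re (mat_trace (D * (T * D)))" by simp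
  then have "S * D = 0\<^sub>m n n" "T * D = 0\<^sub>m n n"
    using kernel nonneg S T by (smt (verit))+
  then have "D * D = 0\<^sub>m n n"
    using S T D by (simp add: D_def minus_mult_distrib_mat[of S n n T])
  have "D $$ (i, j) = 0" if ij: "i < n" "j < n" for i j
  proof -
    have "0 = (D * D) $$ (j, j)" using ij \<open>D * D = _\<close> by simp
    also have "\<dots> = (\<Sum>k<n. D $$ (j, k) * D $$ (k, j))"
      using ij D by (simp add: scalar_prod_def atLeast0LessThan)
    also have "\<dots> = (\<Sum>k<n. complex_of_real ((cmod (D $$ (k, j)))\<^sup>2))"
      by (intro sum.cong) (use ij in \<open>auto simp: herm[of j] complex_norm_square mult.commute
          simp del: of_real_power\<close>)
    finally have "(\<Sum>k<n. (cmod (D $$ (k, j)))\<^sup>2) = 0"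
      by (metis of_real_sum of_real_eq_0_iff)
    then show ?thesis using ij by (subst (asm) sum_nonneg_eq_0_iff) auto
  qed
  then have "S $$ (i, j) = T $$ (i, j)" if "i < n" "j < n" for i j
    using that S T by (simp add: D_def)
  then show ?thesis using S T by (intro eq_matI) auto
qed

section \<open>Trace norm of sums of orthonormal dyads\<close>

text \<open>Vectors are functions of which only the entries below n count. The index type stays free
  because the partial transpose produces families indexed by pairs.\<close>

definition orthonormal :: "nat \<Rightarrow> 'k set \<Rightarrow> ('k \<Rightarrow> nat \<Rightarrow> complex) \<Rightarrow> bool" where
  "orthonormal n K f \<longleftrightarrow>
     (\<forall>k\<in>K. \<forall>l\<in>K. (\<Sum>i<n. f k i * cnj (f l i)) = (if k = l then 1 else 0))"

text \<open>A singular value decomposition with singular values t, once f and g are orthonormal and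
  t is nonnegative.\<close>

definition dyad_sum ::
  "nat \<Rightarrow> 'k set \<Rightarrow> ('k \<Rightarrow> real) \<Rightarrow> ('k \<Rightarrow> nat \<Rightarrow> complex) \<Rightarrow> ('k \<Rightarrow> nat \<Rightarrow> complex) \<Rightarrow> complex mat"
  where "dyad_sum n K t f g =
     mat n n (\<lambda>(i, j). \<Sum>k\<in>K. complex_of_real (t k) * f k i * cnj (g k j))"

lemma orthonormalD:
  assumes "orthonormal n K f" "k \<in> K" "l \<in> K"
  shows "(\<Sum>i<n. f k i * cnj (f l i)) = (if k = l then 1 else 0)"
  using assms unfolding orthonormal_def by blast

lemma dyad_sum_carrier [simp]: "dyad_sum n K t f g \<in> carrier_mat n n"
  and dim_dyad_sum [simp]: "dim_row (dyad_sum n K t f g) = n" "dim_col (dyad_sum n K t f g) = n"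
  by (simp_all add: dyad_sum_def)

lemma mat_adjoint_dyad_sum: "mat_adjoint (dyad_sum n K t f g) = dyad_sum n K t g f"
  by (rule eq_matI) (auto simp: dyad_sum_def algebra_simps)

lemma dyad_sum_mult:
  assumes "finite K" "orthonormal n K g"
  shows "dyad_sum n K s f g * dyad_sum n K t g h = dyad_sum n K (\<lambda>k. s k * t k) f h"
proof (rule eq_matI)
  fix i j assume "i < dim_row (dyad_sum n K (\<lambda>k. s k * t k) f h)"
    "j < dim_col (dyad_sum n K (\<lambda>k. s k * t k) f h)"
  then have ij: "i < n" "j < n" by simp_all
  have "(dyad_sum n K s f g * dyad_sum n K t g h) $$ (i, j)
      = (\<Sum>x<n. (\<Sum>k\<in>K. s k * f k i * cnj (g k x)) * (\<Sum>l\<in>K. t l * g l x * cnj (h l j)))"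
    using ij by (simp add: dyad_sum_def scalar_prod_def atLeast0LessThan)
  also have "\<dots> = (\<Sum>x<n. \<Sum>k\<in>K. \<Sum>l\<in>K. s k * t l * f k i * cnj (h l j) * (g l x * cnj (g k x)))"
    by (simp add: sum_product algebra_simps)
  also have "\<dots> = (\<Sum>k\<in>K. \<Sum>x<n. \<Sum>l\<in>K. s k * t l * f k i * cnj (h l j) * (g l x * cnj (g k x)))"
    by (rule sum.swap)
  also have "\<dots> = (\<Sum>k\<in>K. \<Sum>l\<in>K. \<Sum>x<n. s k * t l * f k i * cnj (h l j) * (g l x * cnj (g k x)))"
    by (intro sum.cong refl, rule sum.swap)
  also have "\<dots> = (\<Sum>k\<in>K. \<Sum>l\<in>K. s k * t l * f k i * cnj (h l j) * (if l = k then 1 else 0))"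
    by (intro sum.cong refl) (simp add: sum_distrib_left[symmetric] orthonormalD[OF assms(2)])
  also have "\<dots> = (\<Sum>k\<in>K. s k * t k * f k i * cnj (h k j))"
    using assms(1) by (intro sum.cong refl) (simp add: if_distrib[of "(*) _"] cong: if_cong)
  finally show "(dyad_sum n K s f g * dyad_sum n K t g h) $$ (i, j)
      = dyad_sum n K (\<lambda>k. s k * t k) f h $$ (i, j)"
    using ij by (simp add: dyad_sum_def)
qed simp_all

lemma psd_dyad_sum:
  assumes "\<And>k. k \<in> K \<Longrightarrow> 0 \<le> t k"
  shows "psd_mat (dyad_sum n K t g g)"
  unfolding psd_mat_def
proof (intro conjI ballI)
  fix v :: "complex vec" assume "v \<in> carrier_vec (dim_row (dyad_sum n K t g g))"
  then have v: "v \<in> carrier_vec n" by simp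
  define q where "q k = (\<Sum>i<n. cnj (v $ i) * g k i)" for k
  have "conjugate v \<bullet> (dyad_sum n K t g g *\<^sub>v v)
      = (\<Sum>i<n. \<Sum>j<n. \<Sum>k\<in>K. t k * ((cnj (v $ i) * g k i) * (cnj (g k j) * v $ j)))"
    using v by (simp add: dyad_sum_def scalar_prod_def atLeast0LessThan sum_distrib_left
        sum_distrib_right algebra_simps)
  also have "\<dots> = (\<Sum>i<n. \<Sum>k\<in>K. \<Sum>j<n. t k * ((cnj (v $ i) * g k i) * (cnj (g k j) * v $ j)))"
    by (intro sum.cong refl, rule sum.swap)
  also have "\<dots> = (\<Sum>k\<in>K. \<Sum>i<n. \<Sum>j<n. t k * ((cnj (v $ i) * g k i) * (cnj (g k j) * v $ j)))"
    by (rule sum.swap)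
  also have "\<dots> = (\<Sum>k\<in>K. t k * (q k * cnj (q k)))"
    by (simp add: q_def sum_product sum_distrib_left algebra_simps)
  also have "\<dots> = complex_of_real (\<Sum>k\<in>K. t k * (cmod (q k))\<^sup>2)"
    by (simp add: complex_norm_square del: of_real_power)
  finally show "0 \<le> Re (conjugate v \<bullet> (dyad_sum n K t g g *\<^sub>v v))"
    using assms by (simp add: sum_nonneg)
qed (simp_all add: mat_adjoint_dyad_sum)

lemma mat_trace_dyad_sum:
  assumes "orthonormal n K g"
  shows "mat_trace (dyad_sum n K t g g) = complex_of_real (\<Sum>k\<in>K. t k)"
proof -
  have "mat_trace (dyad_sum n K t g g) = (\<Sum>i<n. \<Sum>k\<in>K. t k * (g k i * cnj (g k i)))"
    by (simp add: mat_trace_def dyad_sum_def mult.assoc)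
  also have "\<dots> = (\<Sum>k\<in>K. t k * (\<Sum>i<n. g k i * cnj (g k i)))"
    by (subst sum.swap) (simp add: sum_distrib_left)
  also have "\<dots> = (\<Sum>k\<in>K. t k)"
    by (simp add: orthonormalD[OF assms])
  finally show ?thesis by simp
qed

text \<open>Multiplying by the adjoint cancels f and squares the weights, so the square root is the
  same sum with g on both sides and weights t.\<close>

lemma trace_norm_dyad_sum:
  assumes "finite K" "orthonormal n K f" "orthonormal n K g" "\<And>k. k \<in> K \<Longrightarrow> 0 \<le> t k"
  shows "trace_norm (dyad_sum n K t f g) = (\<Sum>k\<in>K. t k)"
proof -
  let ?S = "dyad_sum n K t g g"
  let ?M = "mat_adjoint (dyad_sum n K t f g) * dyad_sum n K t f g"
  have psd: "psd_mat ?S" by (rule psd_dyad_sum) (fact assms(4))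
  have sq: "?S * ?S = ?M"
    using assms by (simp add: mat_adjoint_dyad_sum dyad_sum_mult)
  have "mat_sqrt ?M = ?S" unfolding mat_sqrt_def
  proof (rule the_equality)
    show "psd_mat ?S \<and> ?S * ?S = ?M" using psd sq by simp
  next
    fix S assume S: "psd_mat S \<and> S * S = ?M"
    \<comment> \<open>\<open>psd_mat\<close> fixes no dimension, so the size of a competing root has
      to be recovered from its square.\<close>
    have "dim_row S = dim_row (S * S)" by simp
    also have "\<dots> = n" unfolding conjunct2[OF S] by simp
    finally have "dim_row S = n" .
    then have car: "S \<in> carrier_mat n n" using S unfolding psd_mat_def by blast
    show "S = ?S"
      by (rule psd_sqrt_unique[OF car conjunct1[OF S] dyad_sum_carrier psd])
         (simp only: sq conjunct2[OF S])
  qed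
  then show ?thesis by (simp add: trace_norm_def mat_trace_dyad_sum[OF assms(3)])
qed

section \<open>Row-major indices and orthonormal families on product spaces\<close>

lemma bij_betw_pair_encode:
  "bij_betw (\<lambda>(x, y). x * n + y) ({..<m} \<times> {..<n}) {..<m * n :: nat}"
proof (rule bij_betw_byWitness[where f' = "\<lambda>i. (i div n, i mod n)"])
  show "(\<lambda>(x, y). x * n + y) ` ({..<m} \<times> {..<n}) \<subseteq> {..<m * n}"
  proof clarsimp
    fix x y assume "x < m" "y < n"
    then have "x * n + y < Suc x * n" by simp
    also have "\<dots> \<le> m * n" using \<open>x < m\<close> by (intro mult_le_mono1) simp
    finally show "x * n + y < m * n" .
  qed
  show "(\<lambda>i. (i div n, i mod n)) ` {..<m * n} \<subseteq> {..<m} \<times> {..<n}"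
    by (cases "n = 0") (auto simp: less_mult_imp_div_less)
qed auto

lemma sum_lessThan_mult:
  fixes f :: "nat \<Rightarrow> 'a :: comm_monoid_add"
  shows "(\<Sum>i<m * n. f i) = (\<Sum>x<m. \<Sum>y<n. f (x * n + y))"
  using sum.reindex_bij_betw[OF bij_betw_pair_encode, of f n m]
  by (simp add: sum.cartesian_product case_prod_beta)

lemma orthonormal_product:
  assumes f: "orthonormal m K f" and g: "orthonormal n L g"
  shows "orthonormal (m * n) (K \<times> L) (\<lambda>(k, l) i. f k (i div n) * g l (i mod n))"
proof -
  have "(\<Sum>i<m * n. f k (i div n) * g l (i mod n) * cnj (f k' (i div n) * g l' (i mod n)))
      = (if k = k' \<and> l = l' then 1 else 0)" if "k \<in> K" "k' \<in> K" "l \<in> L" "l' \<in> L" for k k' l l'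
  proof -
    have "(\<Sum>i<m * n. f k (i div n) * g l (i mod n) * cnj (f k' (i div n) * g l' (i mod n)))
        = (\<Sum>x<m. \<Sum>y<n. (f k x * cnj (f k' x)) * (g l y * cnj (g l' y)))"
      unfolding sum_lessThan_mult by (intro sum.cong refl) (simp add: algebra_simps)
    also have "\<dots> = (\<Sum>x<m. f k x * cnj (f k' x)) * (\<Sum>y<n. g l y * cnj (g l' y))"
      by (simp add: sum_product)
    finally show ?thesis using that by (simp add: orthonormalD[OF f] orthonormalD[OF g])
  qed
  then show ?thesis unfolding orthonormal_def by auto
qed

lemma orthonormal_cnj: "orthonormal n K f \<Longrightarrow> orthonormal n K (\<lambda>k i. cnj (f k i))"
  unfolding orthonormal_def
proof (intro ballI)
  fix k l assume H: "\<forall>k\<in>K. \<forall>l\<in>K. (\<Sum>i<n. f k i * cnj (f l i)) = (if k = l then 1 else 0)"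
    and kl: "k \<in> K" "l \<in> K"
  have "(\<Sum>i<n. cnj (f k i) * cnj (cnj (f l i))) = cnj (\<Sum>i<n. f k i * cnj (f l i))" by simp
  then show "(\<Sum>i<n. cnj (f k i) * cnj (cnj (f l i))) = (if k = l then 1 else 0)"
    using H kl by simp
qed

lemma orthonormal_reindex:
  assumes "orthonormal n K f" "inj_on h L" "h ` L \<subseteq> K"
  shows "orthonormal n L (\<lambda>l. f (h l))"
  using assms unfolding orthonormal_def inj_on_def by (auto simp: image_subset_iff)

section \<open>Negativity from a Schmidt decomposition\<close>

text \<open>M holds the amplitudes of a vector and not an operator, hence v enters without
  conjugation. Zero coefficients are allowed.\<close>

definition schmidt ::
  "nat \<Rightarrow> nat \<Rightarrow> (nat \<Rightarrow> nat \<Rightarrow> complex) \<Rightarrow> nat \<Rightarrow> (nat \<Rightarrow> real) \<Rightarrow> (nat \<Rightarrow> nat \<Rightarrow> complex) \<Rightarrow>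
    (nat \<Rightarrow> nat \<Rightarrow> complex) \<Rightarrow> bool"
  where "schmidt m n M r s u v \<longleftrightarrow> orthonormal m {..<r} u \<and> orthonormal n {..<r} v \<and>
     (\<forall>i<r. 0 \<le> s i) \<and> (\<forall>x<m. \<forall>y<n. M x y = (\<Sum>i<r. s i * u i x * v i y))"

text \<open>Exchanging the first-factor indices turns the projector into the sum of s i s j |u i* v
  j><u j* v i|, where * conjugates u. Both product families are orthonormal, being the same family
  up to the swap of (i, j), so the s i s j are the singular values.\<close>

lemma negativity_schmidt:
  assumes \<phi>: "\<phi> \<in> carrier_vec (m * n)"
    and sch: "schmidt m n (\<lambda>x y. \<phi> $ (x * n + y)) r s u v"
  shows "negativity m n (ket_bra \<phi>) = ((\<Sum>i<r. s i)\<^sup>2 - 1) / 2"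
proof -
  have u: "orthonormal m {..<r} u" and v: "orthonormal n {..<r} v" and s: "\<And>i. i < r \<Longrightarrow> 0 \<le> s i"
    and M: "\<And>x y. x < m \<Longrightarrow> y < n \<Longrightarrow> \<phi> $ (x * n + y) = (\<Sum>i<r. s i * u i x * v i y)"
    using sch unfolding schmidt_def by blast+
  define K where "K = {..<r} \<times> {..<r}"
  define t where "t = (\<lambda>(i, j). s i * s j)"
  define e where "e = (\<lambda>(i, j) a. cnj (u i (a div n)) * v j (a mod n))"
  define e' where "e' = (\<lambda>p. e (prod.swap p))"
  have e: "orthonormal (m * n) K e" unfolding K_def e_def
    by (rule orthonormal_product[OF orthonormal_cnj[OF u] v])
  have e': "orthonormal (m * n) K e'" unfolding e'_def
    by (rule orthonormal_reindex[OF e]) (auto simp: K_def)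
  have "partial_transpose1 m n (ket_bra \<phi>) = dyad_sum (m * n) K t e e'"
  proof (rule eq_matI)
    fix a b assume "a < dim_row (dyad_sum (m * n) K t e e')" "b < dim_col (dyad_sum (m * n) K t e e')"
    then have ab: "a < m * n" "b < m * n" by simp_all
    then have n: "n > 0" by (cases n) auto
    have lt: "a div n < m" "b div n < m" "a mod n < n" "b mod n < n"
      using ab n by (simp_all add: less_mult_imp_div_less)
    have bound: "x * n + y < m * n" if "x < m" "y < n" for x y
      using bij_betwE[OF bij_betw_pair_encode[of n m]] that by auto
    have "partial_transpose1 m n (ket_bra \<phi>) $$ (a, b)
        = \<phi> $ (b div n * n + a mod n) * cnj (\<phi> $ (a div n * n + b mod n))"
      using ab \<phi> lt bound by (simp add: partial_transpose1_def ket_bra_def)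
    also have "\<dots> = (\<Sum>j<r. s j * u j (b div n) * v j (a mod n))
        * (\<Sum>i<r. s i * cnj (u i (a div n)) * cnj (v i (b mod n)))"
      using lt by (simp add: M)
    also have "\<dots> = (\<Sum>i<r. \<Sum>j<r. s i * s j * (cnj (u i (a div n)) * v j (a mod n))
        * (u j (b div n) * cnj (v i (b mod n))))"
      unfolding sum_product by (subst sum.swap) (simp add: algebra_simps)
    also have "\<dots> = (\<Sum>(i, j)\<in>K. s i * s j * (cnj (u i (a div n)) * v j (a mod n))
        * (u j (b div n) * cnj (v i (b mod n))))"
      unfolding K_def by (rule sum.cartesian_product)
    also have "\<dots> = dyad_sum (m * n) K t e e' $$ (a, b)"
      using ab by (simp add: dyad_sum_def t_def e_def e'_def case_prod_beta)
    finally show "partial_transpose1 m n (ket_bra \<phi>) $$ (a, b) = dyad_sum (m * n) K t e e' $$ (a, b)" .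
  qed (simp_all add: partial_transpose1_def)
  moreover have "trace_norm (dyad_sum (m * n) K t e e') = (\<Sum>k\<in>K. t k)"
    using s by (intro trace_norm_dyad_sum e e') (auto simp: K_def t_def)
  moreover have "(\<Sum>k\<in>K. t k) = (\<Sum>i<r. s i)\<^sup>2"
    by (simp add: K_def t_def power2_eq_square sum_product sum.cartesian_product)
  ultimately show ?thesis by (simp add: negativity_def)
qed

section \<open>Existence of Schmidt decompositions\<close>

text \<open>The trace survives the passage to Schur form, where it is the sum of the roots of the
  characteristic polynomial; these cannot all vanish.\<close>

lemma nonzero_eigenvalue_if_trace_nonzero:
  fixes A :: "complex mat"
  assumes A: "A \<in> carrier_mat n n" and tr: "mat_trace A \<noteq> 0"
  obtains k where "k \<noteq> 0" "eigenvalue A k"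
proof -
  obtain es where es: "char_poly A = (\<Prod>a\<leftarrow>es. [:- a, 1:])"
    using char_poly_factorized[OF A] by blast
  obtain B P Q where BPQ: "schur_decomposition A es = (B, P, Q)" by (metis prod_cases3)
  from schur_decomposition[OF A es BPQ] have sim: "similar_mat_wit A B P Q" and diag: "diag_mat B = es"
    by auto
  note w = similar_mat_witD2[OF A sim]
  have "mat_trace A = mat_trace (Q * (P * B))"
    using w mat_trace_mult_commute[of "P * B" n n Q] by simp
  also have "Q * (P * B) = B" using w by (simp add: assoc_mult_mat[symmetric, of Q n n P n B n])
  also have "mat_trace B = sum_list es"
    using w by (simp add: mat_trace_def diag[symmetric] diag_mat_def interv_sum_list_conv_sum_set_nat
        atLeast0LessThan)
  finally obtain k where k: "k \<in> set es" "k \<noteq> 0"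
    using tr by (metis sum_list_neutral)
  then have "eigenvalue A k"
    unfolding eigenvalue_root_char_poly[OF A] es by (simp add: poly_prod_list prod_list_zero_iff image_iff)
  with k show thesis using that by blast
qed

text \<open>The Gram matrix H of the columns of M has positive trace, hence an eigenvector w with
  nonzero eigenvalue; w and M w, normalized, give the pair.\<close>

lemma exists_singular_pair:
  fixes M :: "nat \<Rightarrow> nat \<Rightarrow> complex"
  assumes "x0 < m" "y0 < n" "M x0 y0 \<noteq> 0"
  obtains s :: real and u v :: "nat \<Rightarrow> complex" where "s > 0"
    "(\<Sum>x<m. u x * cnj (u x)) = 1" "(\<Sum>y<n. v y * cnj (v y)) = 1"
    "\<And>x. x < m \<Longrightarrow> (\<Sum>y<n. M x y * cnj (v y)) = s * u x"
    "\<And>y. y < n \<Longrightarrow> (\<Sum>x<m. M x y * cnj (u x)) = s * v y"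
proof -
  define H where "H = mat n n (\<lambda>(i, j). \<Sum>x<m. cnj (M x i) * M x j)"
  have H: "H \<in> carrier_mat n n" by (simp add: H_def)
  have "mat_trace H = complex_of_real (\<Sum>i<n. \<Sum>x<m. (cmod (M x i))\<^sup>2)"
    by (simp add: mat_trace_def H_def complex_norm_square mult.commute del: of_real_power)
  moreover have "0 < (\<Sum>x<m. (cmod (M x y0))\<^sup>2)"
    using assms by (intro sum_pos2[of _ x0]) auto
  then have "0 < (\<Sum>i<n. \<Sum>x<m. (cmod (M x i))\<^sup>2)"
    using assms by (subst sum_pos2[of _ y0]) (auto intro: sum_nonneg)
  ultimately have "mat_trace H \<noteq> 0" by (metis less_irrefl of_real_eq_0_iff)
  then obtain k where k: "k \<noteq> 0" "eigenvalue H k"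
    using nonzero_eigenvalue_if_trace_nonzero[OF H] by blast
  then obtain w where w: "w \<in> carrier_vec n" "w \<noteq> 0\<^sub>v n" "H *\<^sub>v w = k \<cdot>\<^sub>v w"
    using H unfolding eigenvalue_def eigenvector_def by auto
  define z where "z x = (\<Sum>y<n. M x y * w $ y)" for x
  have cz: "cnj (z x) = (\<Sum>y<n. cnj (M x y) * cnj (w $ y))" for x by (simp add: z_def)
  have Hw: "(\<Sum>x<m. cnj (M x i) * z x) = k * w $ i" if "i < n" for i
  proof -
    have "k * w $ i = (H *\<^sub>v w) $ i" using w that by simp
    also have "\<dots> = (\<Sum>j<n. \<Sum>x<m. cnj (M x i) * (M x j * w $ j))"
      using w(1) that by (simp add: H_def scalar_prod_def atLeast0LessThan sum_distrib_right mult.assoc)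
    also have "\<dots> = (\<Sum>x<m. cnj (M x i) * z x)"
      by (subst sum.swap) (simp add: z_def sum_distrib_left)
    finally show ?thesis by simp
  qed
  define Z W where "Z = (\<Sum>x<m. (cmod (z x))\<^sup>2)" and "W = (\<Sum>y<n. (cmod (w $ y))\<^sup>2)"
  obtain i where i: "i < n" "w $ i \<noteq> 0" using w by (metis carrier_vecD eq_vecI index_zero_vec)
  have W: "W > 0" unfolding W_def using i by (intro sum_pos2[of _ i]) auto
  \<comment> \<open>So far k is only a nonzero complex number. Pairing the eigenvalue equation with
    w exhibits it as a quotient of squared norms, so it is a positive real and s can be its square
    root.\<close>
  have "k * W = (\<Sum>i<n. cnj (w $ i) * (k * w $ i))"
    by (simp add: W_def complex_norm_square sum_distrib_left algebra_simps del: of_real_power)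
  also have "\<dots> = (\<Sum>i<n. \<Sum>x<m. cnj (w $ i) * (cnj (M x i) * z x))"
    by (intro sum.cong refl) (simp add: Hw[symmetric] sum_distrib_left)
  also have "\<dots> = (\<Sum>x<m. cnj (z x) * z x)"
    by (subst sum.swap) (simp add: cz sum_distrib_left sum_distrib_right ac_simps)
  also have "\<dots> = Z"
    by (simp add: Z_def complex_norm_square algebra_simps del: of_real_power)
  finally have kW: "k * W = Z" .
  define l where "l = Z / W"
  have kl: "k = complex_of_real l" using kW W by (simp add: l_def field_simps)
  have "Z \<ge> 0" by (simp add: Z_def sum_nonneg)
  then have l: "l > 0" using k(1) kl W by (auto simp: l_def less_le)
  define a where "a = sqrt W"
  have a: "a > 0" "a * a = W" using W by (simp_all add: a_def)
  define s where "s = sqrt l"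
  have s: "s > 0" "s * s = l" using l by (simp_all add: s_def)
  \<comment> \<open>v is the conjugate of the normalized w, matching the unconjugated v of
    \<open>schmidt\<close>; a is the norm of w and s * a that of z = M w.\<close>
  define u v where "u x = z x / (s * a)" and "v y = cnj (w $ y) / a" for x y
  show thesis
  proof (rule that[of s u v])
    show "s > 0" by (rule s)
    have "(\<Sum>x<m. u x * cnj (u x)) = (\<Sum>x<m. z x * cnj (z x)) / (s * a * (s * a))"
      by (simp add: u_def sum_divide_distrib)
    also have "\<dots> = Z / (s * s * (a * a))"
      by (simp add: Z_def complex_norm_square algebra_simps del: of_real_power)
    also have "\<dots> = 1" unfolding s(2) a(2) using W l by (auto simp: l_def)
    finally show "(\<Sum>x<m. u x * cnj (u x)) = 1" .
    have "(\<Sum>y<n. v y * cnj (v y)) = (\<Sum>y<n. w $ y * cnj (w $ y)) / (a * a)"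
      by (simp add: v_def sum_divide_distrib mult.commute)
    also have "\<dots> = complex_of_real (W / (a * a))"
      by (simp add: W_def complex_norm_square algebra_simps del: of_real_power)
    also have "\<dots> = 1" unfolding a(2) using W by simp
    finally show "(\<Sum>y<n. v y * cnj (v y)) = 1" .
    show "(\<Sum>y<n. M x y * cnj (v y)) = s * u x" if "x < m" for x
      using s by (simp add: u_def v_def z_def sum_divide_distrib[symmetric])
    show "(\<Sum>x<m. M x y * cnj (u x)) = s * v y" if "y < n" for y
    proof -
      have "(\<Sum>x<m. M x y * cnj (u x)) = cnj (\<Sum>x<m. cnj (M x y) * z x) / (s * a)"
        by (simp add: u_def sum_divide_distrib)
      also have "\<dots> = (s * s) * cnj (w $ y) / (s * a)"
        unfolding Hw[OF that] kl s(2)[symmetric] by simp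
      also have "\<dots> = s * v y" using s(1) a(1) by (simp add: v_def field_simps)
      finally show ?thesis .
    qed
  qed
qed

text \<open>Bessel's inequality for the basis vector at x. Its projection g onto the span satisfies
  g x = b and has squared norm b, and a single entry is bounded by the norm, so b^2 \<le> b.\<close>

lemma orthonormal_sum_le_1:
  assumes f: "orthonormal n K f" and K: "finite K" and x: "x < n"
  shows "(\<Sum>k\<in>K. (cmod (f k x))\<^sup>2) \<le> 1"
proof -
  define b where "b = (\<Sum>k\<in>K. (cmod (f k x))\<^sup>2)"
  define g where "g y = (\<Sum>k\<in>K. cnj (f k x) * f k y)" for y
  have gx: "g x = b" by (simp add: g_def b_def complex_norm_square mult.commute del: of_real_power)
  have "complex_of_real (\<Sum>y<n. (cmod (g y))\<^sup>2) = (\<Sum>y<n. g y * cnj (g y))"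
    by (simp add: complex_norm_square del: of_real_power)
  also have "\<dots> = (\<Sum>y<n. \<Sum>k\<in>K. \<Sum>l\<in>K. cnj (f k x) * f l x * (f k y * cnj (f l y)))"
    by (simp add: g_def sum_product algebra_simps)
  also have "\<dots> = (\<Sum>k\<in>K. \<Sum>y<n. \<Sum>l\<in>K. cnj (f k x) * f l x * (f k y * cnj (f l y)))"
    by (rule sum.swap)
  also have "\<dots> = (\<Sum>k\<in>K. \<Sum>l\<in>K. cnj (f k x) * f l x * (\<Sum>y<n. f k y * cnj (f l y)))"
    unfolding sum_distrib_left by (intro sum.cong refl, rule sum.swap)
  also have "\<dots> = (\<Sum>k\<in>K. \<Sum>l\<in>K. if k = l then cnj (f k x) * f l x else 0)"
    by (intro sum.cong refl) (simp add: orthonormalD[OF f])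
  also have "\<dots> = (\<Sum>k\<in>K. cnj (f k x) * f k x)"
    using K by simp
  also have "\<dots> = b" by (simp add: b_def complex_norm_square mult.commute del: of_real_power)
  finally have "(\<Sum>y<n. (cmod (g y))\<^sup>2) = b" by (simp only: of_real_eq_iff)
  moreover have "(cmod (g x))\<^sup>2 \<le> (\<Sum>y<n. (cmod (g y))\<^sup>2)"
    using x by (intro member_le_sum) auto
  ultimately have "b * b \<le> 1 * b" by (simp add: gx power2_eq_square)
  moreover have "b \<ge> 0" by (simp add: b_def sum_nonneg)
  ultimately have "b \<le> 1" by (cases "b = 0") (auto simp: mult_le_cancel_right)
  then show ?thesis by (simp add: b_def)
qed

text \<open>Double counting of the squared entries: each vector contributes 1, each coordinate at
  most 1. This bounds the length of singular systems and gives a qubit at most two Schmidt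
  coefficients.\<close>

lemma orthonormal_card_le:
  assumes f: "orthonormal n K f" and K: "finite K"
  shows "card K \<le> n"
proof -
  have "real (card K) = (\<Sum>k\<in>K. Re (\<Sum>i<n. f k i * cnj (f k i)))"
    by (simp add: orthonormalD[OF f] del: Re_sum)
  also have "\<dots> = (\<Sum>k\<in>K. \<Sum>i<n. (cmod (f k i))\<^sup>2)"
    by (simp add: complex_norm_square[symmetric] del: of_real_power)
  also have "\<dots> = (\<Sum>i<n. \<Sum>k\<in>K. (cmod (f k i))\<^sup>2)" by (rule sum.swap)
  also have "\<dots> \<le> (\<Sum>i<n. 1)"
    by (rule sum_mono) (use orthonormal_sum_le_1[OF f K] in auto)
  finally show ?thesis by simp
qed

lemma orthonormal_extend:
  assumes f: "orthonormal n {..<r} f" and g: "(\<Sum>i<n. g i * cnj (g i)) = 1"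
    and fg: "\<And>k. k < r \<Longrightarrow> (\<Sum>i<n. g i * cnj (f k i)) = 0"
  shows "orthonormal n {..<Suc r} (f(r := g))"
proof -
  have gf: "(\<Sum>i<n. f k i * cnj (g i)) = 0" if "k < r" for k
  proof -
    have "(\<Sum>i<n. f k i * cnj (g i)) = cnj (\<Sum>i<n. g i * cnj (f k i))" by (simp add: mult.commute)
    then show ?thesis using fg[OF that] by simp
  qed
  show ?thesis
    unfolding orthonormal_def
    using orthonormalD[OF f] g fg gf by (auto simp: less_Suc_eq)
qed

text \<open>Only the pairs split off so far are described, not all of M. Both one-sided relations
  are recorded so that the remainder annihilates the chosen vectors on either side.\<close>

definition singular_system ::
  "nat \<Rightarrow> nat \<Rightarrow> (nat \<Rightarrow> nat \<Rightarrow> complex) \<Rightarrow> nat \<Rightarrow> (nat \<Rightarrow> real) \<Rightarrow> (nat \<Rightarrow> nat \<Rightarrow> complex) \<Rightarrow>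
    (nat \<Rightarrow> nat \<Rightarrow> complex) \<Rightarrow> bool"
  where "singular_system m n M r s u v \<longleftrightarrow> orthonormal m {..<r} u \<and> orthonormal n {..<r} v \<and>
     (\<forall>i<r. 0 < s i) \<and>
     (\<forall>i<r. \<forall>x<m. (\<Sum>y<n. M x y * cnj (v i y)) = s i * u i x) \<and>
     (\<forall>i<r. \<forall>y<n. (\<Sum>x<m. M x y * cnj (u i x)) = s i * v i y)"

text \<open>A nonzero remainder M - \<Sum>i. s i u i v i has a singular pair of its own, which is automatically
  orthogonal to the pairs already split off, so a singular system of maximal length exhausts M.\<close>
lemma singular_system_extend:
  assumes sys: "singular_system m n M r s u v"
    and nz: "x0 < m" "y0 < n" "M x0 y0 \<noteq> (\<Sum>i<r. s i * u i x0 * v i y0)"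
  shows "\<exists>s u v. singular_system m n M (Suc r) s u v"
proof -
  have u: "orthonormal m {..<r} u" and v: "orthonormal n {..<r} v" and s: "\<And>i. i < r \<Longrightarrow> 0 < s i"
    and Mv: "\<And>i x. i < r \<Longrightarrow> x < m \<Longrightarrow> (\<Sum>y<n. M x y * cnj (v i y)) = s i * u i x"
    and Mu: "\<And>i y. i < r \<Longrightarrow> y < n \<Longrightarrow> (\<Sum>x<m. M x y * cnj (u i x)) = s i * v i y"
    using sys unfolding singular_system_def by auto
  define R where "R x y = M x y - (\<Sum>i<r. s i * u i x * v i y)" for x y
  have row: "(\<Sum>y<n. R x y * cnj (q y))
      = (\<Sum>y<n. M x y * cnj (q y)) - (\<Sum>i<r. s i * u i x * (\<Sum>y<n. v i y * cnj (q y)))" for x q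
    by (simp add: R_def left_diff_distrib sum_subtractf sum_distrib_left sum_distrib_right mult.assoc)
       (rule sum.swap)
  have col: "(\<Sum>x<m. R x y * cnj (q x))
      = (\<Sum>x<m. M x y * cnj (q x)) - (\<Sum>i<r. s i * v i y * (\<Sum>x<m. u i x * cnj (q x)))" for y q
    by (simp add: R_def left_diff_distrib sum_subtractf sum_distrib_left sum_distrib_right
        right_diff_distrib ac_simps)
       (rule sum.swap)
  \<comment> \<open>R kills the old vectors, while the new p and q are images under R up to the
    factor t \<noteq> 0; this forces the orthogonality below.\<close>
  have Rv: "(\<Sum>y<n. R x y * cnj (v j y)) = 0" if "j < r" "x < m" for j x
    using that by (simp add: row Mv orthonormalD[OF v] if_distrib[of "(*) _"] cong: if_cong)
  have Ru: "(\<Sum>x<m. R x y * cnj (u j x)) = 0" if "j < r" "y < n" for j y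
    using that by (simp add: col Mu orthonormalD[OF u] if_distrib[of "(*) _"] cong: if_cong)
  have "R x0 y0 \<noteq> 0" using nz by (simp add: R_def)
  then obtain t :: real and p q :: "nat \<Rightarrow> complex" where t: "t > 0" and p: "(\<Sum>x<m. p x * cnj (p x)) = 1"
    and q: "(\<Sum>y<n. q y * cnj (q y)) = 1"
    and Rq: "\<And>x. x < m \<Longrightarrow> (\<Sum>y<n. R x y * cnj (q y)) = t * p x"
    and Rp: "\<And>y. y < n \<Longrightarrow> (\<Sum>x<m. R x y * cnj (p x)) = t * q y"
    by (rule exists_singular_pair[OF nz(1,2)]) blast
  have qv: "(\<Sum>y<n. q y * cnj (v j y)) = 0" if "j < r" for j
  proof -
    have "t * (\<Sum>y<n. q y * cnj (v j y)) = (\<Sum>y<n. \<Sum>x<m. R x y * cnj (p x) * cnj (v j y))"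
      unfolding sum_distrib_left
      by (intro sum.cong refl) (simp add: Rp[symmetric] sum_distrib_right mult.assoc[symmetric])
    also have "\<dots> = (\<Sum>x<m. cnj (p x) * (\<Sum>y<n. R x y * cnj (v j y)))"
      by (subst sum.swap) (simp add: sum_distrib_left ac_simps)
    also have "\<dots> = 0" using that by (simp add: Rv)
    finally show ?thesis using t by simp
  qed
  have pu: "(\<Sum>x<m. p x * cnj (u j x)) = 0" if "j < r" for j
  proof -
    have "t * (\<Sum>x<m. p x * cnj (u j x)) = (\<Sum>x<m. \<Sum>y<n. R x y * cnj (q y) * cnj (u j x))"
      unfolding sum_distrib_left
      by (intro sum.cong refl) (simp add: Rq[symmetric] sum_distrib_right mult.assoc[symmetric])
    also have "\<dots> = (\<Sum>y<n. cnj (q y) * (\<Sum>x<m. R x y * cnj (u j x)))"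
      by (subst sum.swap) (simp add: sum_distrib_left ac_simps)
    also have "\<dots> = 0" using that by (simp add: Ru)
    finally show ?thesis using t by simp
  qed
  have vq: "(\<Sum>y<n. v j y * cnj (q y)) = 0" if "j < r" for j
    using arg_cong[OF qv[OF that], of cnj] by (simp add: mult.commute)
  have up: "(\<Sum>x<m. u j x * cnj (p x)) = 0" if "j < r" for j
    using arg_cong[OF pu[OF that], of cnj] by (simp add: mult.commute)
  \<comment> \<open>By orthogonality the subtracted terms do not see q or p, so a singular pair of R
    is one of M.\<close>
  have Mq: "(\<Sum>y<n. M x y * cnj (q y)) = t * p x" if "x < m" for x
    using Rq[OF that] by (simp add: row vq)
  have Mp: "(\<Sum>x<m. M x y * cnj (p x)) = t * q y" if "y < n" for y
    using Rp[OF that] by (simp add: col up)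
  have "singular_system m n M (Suc r) (s(r := t)) (u(r := p)) (v(r := q))"
    unfolding singular_system_def
    using orthonormal_extend[OF u p pu] orthonormal_extend[OF v q qv] s t Mv Mu Mq Mp
    by (auto simp: less_Suc_eq)
  then show ?thesis by blast
qed

lemma schmidt_exists: "\<exists>r s u v. schmidt m n M r s u v"
proof -
  define Q where "Q r \<longleftrightarrow> (\<exists>s u v. singular_system m n M r s u v)" for r
  have bound: "\<forall>r. Q r \<longrightarrow> r \<le> n"
    using orthonormal_card_le unfolding Q_def singular_system_def by fastforce
  have "Q 0" by (simp add: Q_def singular_system_def orthonormal_def)
  then have max: "Q (Greatest Q)" "\<not> Q (Suc (Greatest Q))"
    using GreatestI_nat[of Q 0 n] Greatest_le_nat[of Q "Suc (Greatest Q)" n] bound by auto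
  define r where "r = Greatest Q"
  obtain s u v where sys: "singular_system m n M r s u v" using max(1) by (auto simp: Q_def r_def)
  have "\<forall>x<m. \<forall>y<n. M x y = (\<Sum>i<r. s i * u i x * v i y)"
    using singular_system_extend[OF sys] max(2) unfolding Q_def r_def by blast
  then have "schmidt m n M r s u v"
    using sys unfolding schmidt_def singular_system_def by (auto intro: less_imp_le)
  then show ?thesis by blast
qed

section \<open>Purities\<close>

text \<open>Tr (\<rho>\<rho>) for the reduced state \<rho> = M M*, i.e. the expectation of the operator swapping the two
  copies of Y in M \<otimes> M.\<close>
definition purity :: "'a set \<Rightarrow> 'b set \<Rightarrow> ('a \<Rightarrow> 'b \<Rightarrow> complex) \<Rightarrow> complex" where
  "purity X Y M =
     (\<Sum>x\<in>X. \<Sum>x'\<in>X. \<Sum>y\<in>Y. \<Sum>y'\<in>Y. M x y * M x' y' * cnj (M x y') * cnj (M x' y))"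

lemma purity_cong:
  assumes "\<And>x y. x \<in> X \<Longrightarrow> y \<in> Y \<Longrightarrow> M x y = N x y"
  shows "purity X Y M = purity X Y N"
  unfolding purity_def by (intro sum.cong refl) (simp add: assms)

text \<open>Negativities live on row-major numbers, the swap argument on tuples; this carries
  purities from one to the other.\<close>

lemma purity_reindex:
  assumes g: "bij_betw g X' X" and h: "bij_betw h Y' Y"
  shows "purity X Y M = purity X' Y' (\<lambda>x y. M (g x) (h y))"
  unfolding purity_def sum.reindex_bij_betw[OF g, symmetric] sum.reindex_bij_betw[OF h, symmetric] ..

text \<open>On \<psi> \<otimes> \<psi> the three purities are expectation values of the operators that swap the two copies of
  A, B or C, and the swap of A acts as the product of the swaps of B and C. The claim is that
  (1 - swap B) (1 - swap C), a product of commuting nonnegative operators, is nonnegative.\<close>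
lemma purity_tripartite_le:
  fixes f :: "'a \<Rightarrow> 'b \<Rightarrow> 'c \<Rightarrow> complex"
  shows "Re (purity (A \<times> C) B (\<lambda>(a, c) b. f a b c)) + Re (purity (A \<times> B) C (\<lambda>(a, b) c. f a b c))
    \<le> (\<Sum>a\<in>A. \<Sum>b\<in>B. \<Sum>c\<in>C. (cmod (f a b c))\<^sup>2)\<^sup>2 + Re (purity A (C \<times> B) (\<lambda>a (c, b). f a b c))"
proof -
  define D where "D = (A \<times> B \<times> C) \<times> (A \<times> B \<times> C)"
  define F where "F = (\<lambda>(a, b, c). f a b c)"
  define T where "T = (\<lambda>(p, q). F p * F q)"
  define \<beta> where "\<beta> = (\<lambda>((a, b, c), (a', b', c')). ((a :: 'a, b' :: 'b, c :: 'c), (a' :: 'a, b :: 'b, c' :: 'c)))"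
  define \<gamma> where "\<gamma> = (\<lambda>((a, b, c), (a', b', c')). ((a :: 'a, b :: 'b, c' :: 'c), (a' :: 'a, b' :: 'b, c :: 'c)))"
  \<comment> \<open>V is (1 - \<beta>)(1 - \<gamma>) applied to T, the amplitudes of \<psi>
    \<otimes> \<psi>. As \<beta> and \<gamma> are commuting involutions, this operator is 4 times a
    projection, so the squared norm of V is 4 times the inner product I of V with T.\<close>
  define V where "V t = T t - T (\<beta> t) - T (\<gamma> t) + T (\<beta> (\<gamma> t))" for t
  have inv: "\<beta> (\<beta> t) = t" "\<gamma> (\<gamma> t) = t" "\<gamma> (\<beta> t) = \<beta> (\<gamma> t)" for t
    by (simp_all add: \<beta>_def \<gamma>_def split: prod.splits)
  have D: "\<beta> t \<in> D" "\<gamma> t \<in> D" if "t \<in> D" for t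
    using that by (auto simp: D_def \<beta>_def \<gamma>_def)
  have V\<beta>: "V (\<beta> t) = - V t" and V\<gamma>: "V (\<gamma> t) = - V t" for t
    using inv(1)[of "\<gamma> t"] by (simp_all add: V_def inv)
  define I where "I = (\<Sum>t\<in>D. V t * cnj (T t))"
  have re\<beta>: "(\<Sum>t\<in>D. g (\<beta> t)) = (\<Sum>t\<in>D. g t)" for g :: "_ \<Rightarrow> complex"
    by (rule sum.reindex_bij_witness[of _ \<beta> \<beta>]) (auto simp: inv D)
  have re\<gamma>: "(\<Sum>t\<in>D. g (\<gamma> t)) = (\<Sum>t\<in>D. g t)" for g :: "_ \<Rightarrow> complex"
    by (rule sum.reindex_bij_witness[of _ \<gamma> \<gamma>]) (auto simp: inv D)
  have I\<beta>: "(\<Sum>t\<in>D. V t * cnj (T (\<beta> t))) = - I"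
    using re\<beta>[of "\<lambda>t. V t * cnj (T (\<beta> t))"] by (simp add: inv V\<beta> I_def sum_negf)
  have I\<gamma>: "(\<Sum>t\<in>D. V t * cnj (T (\<gamma> t))) = - I"
    using re\<gamma>[of "\<lambda>t. V t * cnj (T (\<gamma> t))"] by (simp add: inv V\<gamma> I_def sum_negf)
  have I\<beta>\<gamma>: "(\<Sum>t\<in>D. V t * cnj (T (\<beta> (\<gamma> t)))) = I"
    using re\<gamma>[of "\<lambda>t. V t * cnj (T (\<beta> (\<gamma> t)))"] I\<beta> by (simp add: inv V\<gamma> sum_negf)
  have "(\<Sum>t\<in>D. V t * cnj (V t)) = (\<Sum>t\<in>D. V t * cnj (T t)) - (\<Sum>t\<in>D. V t * cnj (T (\<beta> t)))
      - (\<Sum>t\<in>D. V t * cnj (T (\<gamma> t))) + (\<Sum>t\<in>D. V t * cnj (T (\<beta> (\<gamma> t))))"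
    unfolding sum_subtractf[symmetric] sum.distrib[symmetric]
    by (intro sum.cong refl) (simp add: V_def right_diff_distrib distrib_left)
  also have "\<dots> = 4 * I" by (simp add: I_def[symmetric] I\<beta> I\<gamma> I\<beta>\<gamma>)
  finally have "4 * I = complex_of_real (\<Sum>t\<in>D. (cmod (V t))\<^sup>2)"
    by (simp add: complex_norm_square del: of_real_power)
  then have "Re (4 * I) = (\<Sum>t\<in>D. (cmod (V t))\<^sup>2)" by (simp only: Re_complex_of_real)
  moreover have "0 \<le> (\<Sum>t\<in>D. (cmod (V t))\<^sup>2)" by (simp add: sum_nonneg)
  ultimately have I: "0 \<le> Re I" by simp
  have "(\<Sum>t\<in>D. T t * cnj (T t)) = complex_of_real ((\<Sum>p\<in>A \<times> B \<times> C. (cmod (F p))\<^sup>2)\<^sup>2)"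
    unfolding power2_eq_square[of "sum _ _"] sum_product sum.cartesian_product D_def[symmetric]
    by (simp add: T_def complex_norm_square case_prod_beta algebra_simps del: of_real_power)
  also have "(\<Sum>p\<in>A \<times> B \<times> C. (cmod (F p))\<^sup>2) = (\<Sum>a\<in>A. \<Sum>b\<in>B. \<Sum>c\<in>C. (cmod (f a b c))\<^sup>2)"
    by (simp add: F_def sum.cartesian_product case_prod_beta)
  finally have 1: "(\<Sum>t\<in>D. T t * cnj (T t))
      = complex_of_real ((\<Sum>a\<in>A. \<Sum>b\<in>B. \<Sum>c\<in>C. (cmod (f a b c))\<^sup>2)\<^sup>2)" .
  \<comment> \<open>The witnesses exchange the two copies of the traced index, since
    \<open>purity\<close> carries the swap on its conjugated factors and the sum over D carries it
    on the others.\<close>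
  have 2: "(\<Sum>t\<in>D. T (\<beta> t) * cnj (T t)) = purity (A \<times> C) B (\<lambda>(a, c) b. f a b c)"
    unfolding purity_def sum.cartesian_product D_def
    by (rule sum.reindex_bij_witness[of _ "\<lambda>((a, c), (a', c'), b, b'). ((a, b', c), (a', b, c'))"
          "\<lambda>((a, b, c), (a', b', c')). ((a, c), (a', c'), b', b)"])
       (auto simp: T_def F_def \<beta>_def)
  have 3: "(\<Sum>t\<in>D. T (\<gamma> t) * cnj (T t)) = purity (A \<times> B) C (\<lambda>(a, b) c. f a b c)"
    unfolding purity_def sum.cartesian_product D_def
    by (rule sum.reindex_bij_witness[of _ "\<lambda>((a, b), (a', b'), c, c'). ((a, b, c'), (a', b', c))"
          "\<lambda>((a, b, c), (a', b', c')). ((a, b), (a', b'), c', c)"])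
       (auto simp: T_def F_def \<gamma>_def)
  have 4: "(\<Sum>t\<in>D. T (\<beta> (\<gamma> t)) * cnj (T t)) = purity A (C \<times> B) (\<lambda>a (c, b). f a b c)"
    unfolding purity_def sum.cartesian_product D_def
    by (rule sum.reindex_bij_witness[of _ "\<lambda>(a, a', (c, b), (c', b')). ((a, b', c'), (a', b, c))"
          "\<lambda>((a, b, c), (a', b', c')). (a, a', (c', b'), (c, b))"])
       (auto simp: T_def F_def \<beta>_def \<gamma>_def)
  have "I = (\<Sum>t\<in>D. T t * cnj (T t)) - (\<Sum>t\<in>D. T (\<beta> t) * cnj (T t))
      - (\<Sum>t\<in>D. T (\<gamma> t) * cnj (T t)) + (\<Sum>t\<in>D. T (\<beta> (\<gamma> t)) * cnj (T t))"
    unfolding I_def sum_subtractf[symmetric] sum.distrib[symmetric]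
    by (intro sum.cong refl) (simp add: V_def left_diff_distrib distrib_right)
  with I show ?thesis unfolding 1 2 3 4 by simp
qed

text \<open>Tracing out the second factor leaves the spectral form of the reduced state, with
  eigenvalues the squares of s. Norm and purity become traces of it and of its square.\<close>

lemma schmidt_gram:
  assumes "schmidt m n M r s u v" "x < m" "x' < m"
  shows "(\<Sum>y<n. M x y * cnj (M x' y)) = (\<Sum>i<r. complex_of_real ((s i)\<^sup>2) * u i x * cnj (u i x'))"
proof -
  have v: "orthonormal n {..<r} v"
    and M: "\<And>x y. x < m \<Longrightarrow> y < n \<Longrightarrow> M x y = (\<Sum>i<r. s i * u i x * v i y)"
    using assms(1) unfolding schmidt_def by blast+
  have "(\<Sum>y<n. M x y * cnj (M x' y))
      = (\<Sum>y<n. \<Sum>i<r. \<Sum>j<r. s i * s j * u i x * cnj (u j x') * (v i y * cnj (v j y)))"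
    using assms by (simp add: M sum_product algebra_simps)
  also have "\<dots> = (\<Sum>i<r. \<Sum>y<n. \<Sum>j<r. s i * s j * u i x * cnj (u j x') * (v i y * cnj (v j y)))"
    by (rule sum.swap)
  also have "\<dots> = (\<Sum>i<r. \<Sum>j<r. s i * s j * u i x * cnj (u j x') * (\<Sum>y<n. v i y * cnj (v j y)))"
    unfolding sum_distrib_left by (rule sum.cong[OF refl], rule sum.swap)
  also have "\<dots> = (\<Sum>i<r. \<Sum>j<r. if i = j then s i * s j * u i x * cnj (u j x') else 0)"
    by (intro sum.cong refl) (simp add: orthonormalD[OF v])
  also have "\<dots> = (\<Sum>i<r. complex_of_real ((s i)\<^sup>2) * u i x * cnj (u i x'))"
    by (simp add: power2_eq_square)
  finally show ?thesis .
qed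

lemma schmidt_norm:
  assumes "schmidt m n M r s u v"
  shows "(\<Sum>x<m. \<Sum>y<n. (cmod (M x y))\<^sup>2) = (\<Sum>i<r. (s i)\<^sup>2)"
proof -
  have u: "orthonormal m {..<r} u" using assms by (simp add: schmidt_def)
  have "complex_of_real (\<Sum>x<m. \<Sum>y<n. (cmod (M x y))\<^sup>2) = (\<Sum>x<m. \<Sum>y<n. M x y * cnj (M x y))"
    by (simp add: complex_norm_square del: of_real_power)
  also have "\<dots> = mat_trace (dyad_sum m {..<r} (\<lambda>i. (s i)\<^sup>2) u u)"
    by (simp add: mat_trace_def dyad_sum_def schmidt_gram[OF assms])
  finally show ?thesis unfolding mat_trace_dyad_sum[OF u] of_real_eq_iff .
qed

lemma schmidt_purity:
  assumes "schmidt m n M r s u v"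
  shows "purity {..<m} {..<n} M = complex_of_real (\<Sum>i<r. (s i) ^ 4)"
proof -
  have u: "orthonormal m {..<r} u" using assms by (simp add: schmidt_def)
  let ?\<rho> = "dyad_sum m {..<r} (\<lambda>i. (s i)\<^sup>2) u u"
  have "purity {..<m} {..<n} M
      = (\<Sum>x<m. \<Sum>x'<m. (\<Sum>y<n. M x y * cnj (M x' y)) * (\<Sum>y<n. M x' y * cnj (M x y)))"
    by (simp add: purity_def sum_product algebra_simps)
  also have "\<dots> = mat_trace (?\<rho> * ?\<rho>)"
    by (simp add: mat_trace_def scalar_prod_def atLeast0LessThan schmidt_gram[OF assms])
       (simp add: dyad_sum_def)
  also have "?\<rho> * ?\<rho> = dyad_sum m {..<r} (\<lambda>i. (s i) ^ 4) u u"
    by (simp add: dyad_sum_mult[OF _ u] flip: power_add)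
  finally show ?thesis unfolding mat_trace_dyad_sum[OF u] .
qed

section \<open>Inequalities between Schmidt coefficients, and negativity against purity\<close>

lemma sum_squares_le_square_sum:
  fixes s :: "nat \<Rightarrow> real"
  assumes "\<And>i. i < r \<Longrightarrow> 0 \<le> s i"
  shows "(\<Sum>i<r. (s i)\<^sup>2) \<le> (\<Sum>i<r. s i)\<^sup>2"
  using assms
proof (induction r)
  case (Suc r)
  then have "0 \<le> s r * (\<Sum>i<r. s i)" by (intro mult_nonneg_nonneg sum_nonneg) auto
  then show ?case using Suc by (simp add: power2_sum algebra_simps)
qed simp

text \<open>With p running over the products s i s j of unordered pairs, the left side is 4 times
  the sum of the p^2 and the right side 4 times the square of the sum of the p; the slack consists
  of nonnegative cross terms.\<close>

lemma pair_sum_square_ge: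
  fixes s :: "nat \<Rightarrow> real"
  assumes "\<And>i. i < r \<Longrightarrow> 0 \<le> s i"
  shows "2 * ((\<Sum>i<r. (s i)\<^sup>2)\<^sup>2 - (\<Sum>i<r. (s i) ^ 4)) \<le> ((\<Sum>i<r. s i)\<^sup>2 - (\<Sum>i<r. (s i)\<^sup>2))\<^sup>2"
  using assms
proof (induction r)
  case (Suc r)
  define a S Q F where "a = s r" and "S = (\<Sum>i<r. s i)" and "Q = (\<Sum>i<r. (s i)\<^sup>2)"
    and "F = (\<Sum>i<r. (s i) ^ 4)"
  have nonneg: "0 \<le> a" "0 \<le> S" using Suc by (auto simp: a_def S_def intro: sum_nonneg)
  have QS: "Q \<le> S\<^sup>2" unfolding Q_def S_def by (rule sum_squares_le_square_sum) (simp add: Suc)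
  have IH: "2 * (Q\<^sup>2 - F) \<le> (S\<^sup>2 - Q)\<^sup>2" using Suc unfolding Q_def S_def F_def by simp
  have "2 * ((Q + a\<^sup>2)\<^sup>2 - (F + a ^ 4)) = 2 * (Q\<^sup>2 - F) + 4 * a\<^sup>2 * Q"
    by (simp add: power2_eq_square power4_eq_xxxx algebra_simps)
  also have "\<dots> \<le> (S\<^sup>2 - Q)\<^sup>2 + 4 * a\<^sup>2 * S\<^sup>2 + 4 * a * S * (S\<^sup>2 - Q)"
    using IH QS nonneg by (intro add_increasing2 add_mono mult_left_mono mult_nonneg_nonneg) auto
  also have "\<dots> = ((S + a)\<^sup>2 - (Q + a\<^sup>2))\<^sup>2"
    by (simp add: power2_eq_square algebra_simps)
  finally show ?case by (simp add: a_def S_def Q_def F_def)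
qed simp

text \<open>Two coefficients form a single unordered pair, so there are no cross terms to
  lose.\<close>

lemma pair_sum_square_eq:
  fixes s :: "nat \<Rightarrow> real"
  assumes "r \<le> 2"
  shows "((\<Sum>i<r. s i)\<^sup>2 - (\<Sum>i<r. (s i)\<^sup>2))\<^sup>2 = 2 * ((\<Sum>i<r. (s i)\<^sup>2)\<^sup>2 - (\<Sum>i<r. (s i) ^ 4))"
proof -
  consider "r = 0" | "r = 1" | "r = 2" using assms by linarith
  then show ?thesis
    by cases (auto simp: numeral_2_eq_2 power2_eq_square power4_eq_xxxx algebra_simps)
qed

lemma negativity_purity:
  assumes \<phi>: "\<phi> \<in> carrier_vec (m * n)" and unit: "unit_vec_c \<phi>"
  defines "N \<equiv> negativity m n (ket_bra \<phi>)"
    and "P \<equiv> Re (purity {..<m} {..<n} (\<lambda>x y. \<phi> $ (x * n + y)))"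
  shows "0 \<le> N" "2 * (1 - P) \<le> (2 * N)\<^sup>2" "m \<le> 2 \<Longrightarrow> (2 * N)\<^sup>2 = 2 * (1 - P)"
proof -
  obtain r s u v where sch: "schmidt m n (\<lambda>x y. \<phi> $ (x * n + y)) r s u v"
    using schmidt_exists by blast
  have s: "\<And>i. i < r \<Longrightarrow> 0 \<le> s i" and u: "orthonormal m {..<r} u"
    using sch by (auto simp: schmidt_def)
  have "(\<Sum>i<r. (s i)\<^sup>2) = (\<Sum>x<m. \<Sum>y<n. (cmod (\<phi> $ (x * n + y)))\<^sup>2)"
    by (rule schmidt_norm[OF sch, symmetric])
  also have "\<dots> = 1" using unit \<phi> by (simp add: unit_vec_c_def sum_lessThan_mult)
  finally have Q: "(\<Sum>i<r. (s i)\<^sup>2) = 1" .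
  have P: "P = (\<Sum>i<r. (s i) ^ 4)" by (simp add: P_def schmidt_purity[OF sch] del: of_real_sum)
  have N: "2 * N = (\<Sum>i<r. s i)\<^sup>2 - 1" by (simp add: N_def negativity_schmidt[OF \<phi> sch])
  show "0 \<le> N" using sum_squares_le_square_sum[of r s] s N Q by simp
  show "2 * (1 - P) \<le> (2 * N)\<^sup>2" unfolding N P using pair_sum_square_ge[of r s] s Q by simp
  show "(2 * N)\<^sup>2 = 2 * (1 - P)" if "m \<le> 2"
  proof -
    have "r \<le> 2" using orthonormal_card_le[OF u] that by simp
    then show ?thesis unfolding N P using pair_sum_square_eq[of r s] Q by simp
  qed
qed

section \<open>Tripartite indices and the inequality for a qubit\<close>

lemma index_reorder_ACB:
  assumes "a < dA" "b < dB" "c < dC"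
  shows "reorder_ACB dA dB dC \<psi> $ ((a * dC + c) * dB + b) = amp dB dC \<psi> a b c"
proof -
  have 1: "a * dC + c < dA * dC"
    using bij_betwE[OF bij_betw_pair_encode[of dC dA]] assms by auto
  then have 2: "(a * dC + c) * dB + b < dA * dC * dB"
    using bij_betwE[OF bij_betw_pair_encode[of dB "dA * dC"]] assms by auto
  have 3: "((a * dC + c) * dB + b) div dB = a * dC + c" using assms by simp
  have "((a * dC + c) * dB + b) div (dC * dB) = ((a * dC + c) * dB + b) div dB div dC"
    by (simp add: div_mult2_eq mult.commute[of dC])
  also have "\<dots> = a" unfolding 3 using assms by simp
  finally show ?thesis using 2 3 assms by (simp add: reorder_ACB_def)
qed

lemma unit_vec_c_reorder_ACB:
  assumes \<psi>: "\<psi> \<in> carrier_vec (dA * dB * dC)"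
  shows "unit_vec_c (reorder_ACB dA dB dC \<psi>) \<longleftrightarrow> unit_vec_c \<psi>"
proof -
  have "(\<Sum>i<dA * dC * dB. (cmod (reorder_ACB dA dB dC \<psi> $ i))\<^sup>2)
      = (\<Sum>a<dA. \<Sum>c<dC. \<Sum>b<dB. (cmod (amp dB dC \<psi> a b c))\<^sup>2)"
    unfolding sum_lessThan_mult by (intro sum.cong refl) (simp add: index_reorder_ACB)
  also have "\<dots> = (\<Sum>a<dA. \<Sum>b<dB. \<Sum>c<dC. (cmod (amp dB dC \<psi> a b c))\<^sup>2)"
    by (rule sum.cong[OF refl], rule sum.swap)
  also have "\<dots> = (\<Sum>i<dA * dB * dC. (cmod (\<psi> $ i))\<^sup>2)"
    unfolding sum_lessThan_mult amp_def ..
  finally show ?thesis using \<psi> by (simp add: unit_vec_c_def reorder_ACB_def)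
qed

lemma negativity_qubit_le:
  assumes \<psi>: "\<psi> \<in> carrier_vec (2 * dB * dC)" and unit: "unit_vec_c \<psi>"
  shows "neg_A_CB 2 dB dC \<psi> \<le> neg_AC_B 2 dB dC \<psi> + neg_AB_C 2 dB dC \<psi>"
proof -
  define \<phi> where "\<phi> = reorder_ACB 2 dB dC \<psi>"
  define f where "f = amp dB dC \<psi>"
  have \<phi>: "\<phi> \<in> carrier_vec (2 * dC * dB)" "\<phi> \<in> carrier_vec (2 * (dC * dB))"
    by (auto simp: \<phi>_def reorder_ACB_def mult.assoc intro!: carrier_vecI)
  have unit\<phi>: "unit_vec_c \<phi>" using unit \<psi> by (simp add: \<phi>_def unit_vec_c_reorder_ACB)
  have \<phi>_idx: "\<phi> $ ((a * dC + c) * dB + b) = f a b c" if "a < 2" "b < dB" "c < dC" for a b c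
    using that by (simp add: \<phi>_def f_def index_reorder_ACB)
  define PA where "PA = Re (purity {..<2} ({..<dC} \<times> {..<dB}) (\<lambda>a (c, b). f a b c))"
  define PB where "PB = Re (purity ({..<2} \<times> {..<dC}) {..<dB} (\<lambda>(a, c) b. f a b c))"
  define PC where "PC = Re (purity ({..<2} \<times> {..<dB}) {..<dC} (\<lambda>(a, b) c. f a b c))"
  have id: "bij_betw (\<lambda>x. x) X X" for X :: "nat set" by (simp add: bij_betw_def)
  \<comment> \<open>The cuts A:CB and AC:B read the same vector \<phi>; a * (dC * dB) + (c * dB + b)
    and (a * dC + c) * dB + b are two groupings of one index.\<close>
  have A: "purity {..<2} {..<dC * dB} (\<lambda>x y. \<phi> $ (x * (dC * dB) + y))
      = purity {..<2} ({..<dC} \<times> {..<dB}) (\<lambda>a (c, b). f a b c)"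
    unfolding purity_reindex[OF id bij_betw_pair_encode]
    by (rule purity_cong) (auto simp: \<phi>_idx[symmetric] algebra_simps)
  have B: "purity {..<2 * dC} {..<dB} (\<lambda>x y. \<phi> $ (x * dB + y))
      = purity ({..<2} \<times> {..<dC}) {..<dB} (\<lambda>(a, c) b. f a b c)"
    unfolding purity_reindex[OF bij_betw_pair_encode id]
    by (rule purity_cong) (auto simp: \<phi>_idx)
  have C: "purity {..<2 * dB} {..<dC} (\<lambda>x y. \<psi> $ (x * dC + y))
      = purity ({..<2} \<times> {..<dB}) {..<dC} (\<lambda>(a, b) c. f a b c)"
    unfolding purity_reindex[OF bij_betw_pair_encode id]
    by (rule purity_cong) (auto simp: f_def amp_def)
  have "(\<Sum>a<2. \<Sum>b<dB. \<Sum>c<dC. (cmod (f a b c))\<^sup>2) = 1"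
    using unit \<psi> by (simp add: unit_vec_c_def sum_lessThan_mult f_def amp_def del: sum.lessThan_Suc)
  then have tri: "PB + PC \<le> 1 + PA"
    using purity_tripartite_le[of "{..<2}" "{..<dC}" "{..<dB}" f] by (simp add: PA_def PB_def PC_def)
  have NA: "(2 * neg_A_CB 2 dB dC \<psi>)\<^sup>2 = 2 * (1 - PA)"
    using negativity_purity(3)[OF \<phi>(2) unit\<phi>] by (simp add: A PA_def neg_A_CB_def \<phi>_def[symmetric])
  have NB: "2 * (1 - PB) \<le> (2 * neg_AC_B 2 dB dC \<psi>)\<^sup>2" "0 \<le> neg_AC_B 2 dB dC \<psi>"
    using negativity_purity(1,2)[OF \<phi>(1) unit\<phi>] by (simp_all add: B PB_def neg_AC_B_def \<phi>_def[symmetric])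
  have NC: "2 * (1 - PC) \<le> (2 * neg_AB_C 2 dB dC \<psi>)\<^sup>2" "0 \<le> neg_AB_C 2 dB dC \<psi>"
    using negativity_purity(1,2)[OF \<psi> unit] by (simp_all add: C PC_def neg_AB_C_def)
  have le_add: "x \<le> y + z" if "(2 * x)\<^sup>2 \<le> (2 * y)\<^sup>2 + (2 * z)\<^sup>2" "0 \<le> y" "0 \<le> z" for x y z :: real
  proof (rule power2_le_imp_le)
    have "0 \<le> y * z" using that by simp
    then show "x\<^sup>2 \<le> (y + z)\<^sup>2" using that(1) by (simp add: power2_sum power_mult_distrib)
  qed (use that in simp)
  have "2 * (1 - PA) \<le> 2 * (1 - PB) + 2 * (1 - PC)" using tri by (simp add: algebra_simps)
  also have "\<dots> \<le> (2 * neg_AC_B 2 dB dC \<psi>)\<^sup>2 + (2 * neg_AB_C 2 dB dC \<psi>)\<^sup>2"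
    by (rule add_mono[OF NB(1) NC(1)])
  finally show ?thesis unfolding NA[symmetric] by (rule le_add[OF _ NB(2) NC(2)])
qed

section \<open>The counterexample and the theorem\<close>

lemma orthonormal_delta:
  assumes "inj_on p K" "p ` K \<subseteq> {..<n}"
  shows "orthonormal n K (\<lambda>k i. if i = p k then 1 else 0)"
  unfolding orthonormal_def
proof (intro ballI)
  fix k l assume kl: "k \<in> K" "l \<in> K"
  have "(\<Sum>i<n. (if i = p k then 1 else 0) * cnj (if i = p l then 1 else 0))
      = (\<Sum>i<n. if i = p k then (if k = l then 1 else 0) else 0 :: complex)"
    using kl assms(1) by (intro sum.cong) (auto dest: inj_onD)
  then show "(\<Sum>i<n. (if i = p k then 1 else 0) * cnj (if i = p l then 1 else 0))
      = (if k = l then 1 else 0 :: complex)"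
    using kl assms(2) by auto
qed

text \<open>Two of the three terms share a value of the qubit and merge into one Schmidt vector. The
  coefficients are 1 / sqrt 3 and sqrt 2 / sqrt 3, and with only two of them the negativity is their
  product. y0 is the value that occurs once.\<close>

lemma negativity_three_terms:
  assumes \<phi>: "\<phi> \<in> carrier_vec (m * 2)" and lt: "p < m" "q < m" "r < m" and ne: "p \<noteq> q" "p \<noteq> r" "q \<noteq> r"
    and y0: "y0 < 2"
    and ent: "\<And>x y. x < m \<Longrightarrow> y < 2 \<Longrightarrow> \<phi> $ (x * 2 + y)
      = (if y = y0 then (if x = p then 1 / sqrt 3 else 0) else (if x = q \<or> x = r then 1 / sqrt 3 else 0))"
  shows "negativity m 2 (ket_bra \<phi>) = sqrt 2 / 3"
proof -
  define u :: "nat \<Rightarrow> nat \<Rightarrow> complex" where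
    "u i x = (if i = 0 then (if x = p then 1 else 0) else (if x = q \<or> x = r then 1 / sqrt 2 else 0))" for i x
  define v :: "nat \<Rightarrow> nat \<Rightarrow> complex" where
    "v i y = (if y = (if i = 0 then y0 else 1 - y0) then 1 else 0)" for i y
  define s where "s i = (if i = 0 then 1 / sqrt 3 else sqrt 2 / sqrt 3)" for i :: nat
  have "orthonormal m {..<2} u"
    unfolding orthonormal_def
  proof (intro ballI)
    fix k l :: nat assume kl: "k \<in> {..<2}" "l \<in> {..<2}"
    have "(\<Sum>x<m. u k x * cnj (u l x)) = (\<Sum>x\<in>{p, q, r}. u k x * cnj (u l x))"
      by (rule sum.mono_neutral_right) (use lt in \<open>auto simp: u_def\<close>)
    also have "\<dots> = u k p * cnj (u l p) + u k q * cnj (u l q) + u k r * cnj (u l r)"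
      using ne by simp
    also have "\<dots> = (if k = l then 1 else 0)"
      using kl ne by (auto simp: u_def less_2_cases_iff simp flip: of_real_mult)
    finally show "(\<Sum>x<m. u k x * cnj (u l x)) = (if k = l then 1 else 0)" .
  qed
  moreover have "orthonormal 2 {..<2} v"
    unfolding v_def by (rule orthonormal_delta) (use y0 in \<open>auto simp: inj_on_def less_2_cases_iff\<close>)
  moreover have "\<phi> $ (x * 2 + y) = (\<Sum>i<2. s i * u i x * v i y)" if "x < m" "y < 2" for x y
    unfolding ent[OF that] using that y0
    by (auto simp: s_def u_def v_def numeral_2_eq_2 less_Suc_eq)
  ultimately have sch: "schmidt m 2 (\<lambda>x y. \<phi> $ (x * 2 + y)) 2 s u v"
    by (simp add: schmidt_def s_def)
  moreover have "(\<Sum>i<2. s i)\<^sup>2 = 1 + 2 * sqrt 2 / 3"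
  proof -
    have "(\<Sum>i<2. s i) = (1 + sqrt 2) / sqrt 3" by (simp add: s_def numeral_2_eq_2 add_divide_distrib)
    then show ?thesis by (simp add: power_divide power2_sum)
  qed
  ultimately show ?thesis using negativity_schmidt[OF \<phi> sch] by simp
qed

text \<open>The state (|001> + |110> + |211>) / sqrt 3 has N = 1 for A : CB, the maximum for a qutrit,
  while the cuts at the qubits B and C give sqrt 2 / 3 each.\<close>
lemma negativity_qutrit_counterexample:
  assumes dA: "dA \<ge> 3"
  defines "\<psi> \<equiv> vec (dA * 2 * 2) (\<lambda>i. if i \<in> {1, 6, 11} then complex_of_real (1 / sqrt 3) else 0)"
  shows "unit_vec_c \<psi>" "neg_AC_B dA 2 2 \<psi> + neg_AB_C dA 2 2 \<psi> < neg_A_CB dA 2 2 \<psi>"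
proof -
  have \<psi>: "\<psi> \<in> carrier_vec (dA * 2 * 2)" by (simp add: \<psi>_def)
  \<comment> \<open>The positions 1, 6, 11 are (a * 2 + b) * 2 + c for the terms 001, 110,
    211.\<close>
  have \<psi>_idx: "\<psi> $ i = (if i \<in> {1, 6, 11} then complex_of_real (1 / sqrt 3) else 0)" if "i < dA * 2 * 2" for i
    using that by (simp add: \<psi>_def)
  have "(\<Sum>i<dA * 2 * 2. (cmod (\<psi> $ i))\<^sup>2) = (\<Sum>i\<in>{1, 6, 11 :: nat}. 1 / 3 :: real)"
    by (rule sum.mono_neutral_cong_right) (use dA in \<open>auto simp: \<psi>_idx norm_divide power_divide\<close>)
  then show "unit_vec_c \<psi>" using \<psi> by (simp add: unit_vec_c_def)
  define \<phi> where "\<phi> = reorder_ACB dA 2 2 \<psi>"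
  have \<phi>: "\<phi> \<in> carrier_vec (dA * 2 * 2)" "\<phi> \<in> carrier_vec (dA * (2 * 2))"
    by (auto simp: \<phi>_def reorder_ACB_def intro!: carrier_vecI)
  have \<phi>_idx: "\<phi> $ ((a * 2 + c) * 2 + b)
      = (if (a, b, c) \<in> {(0, 0, 1), (1, 1, 0), (2, 1, 1)} then complex_of_real (1 / sqrt 3) else 0)"
    if "a < dA" "b < 2" "c < 2" for a b c
  proof -
    have "\<phi> $ ((a * 2 + c) * 2 + b) = \<psi> $ ((a * 2 + b) * 2 + c)"
      unfolding \<phi>_def index_reorder_ACB[OF that] amp_def ..
    moreover have "(a * 2 + b) * 2 + c < dA * 2 * 2" using that by presburger
    moreover have "(a * 2 + b) * 2 + c \<in> {1, 6, 11} \<longleftrightarrow> (a, b, c) \<in> {(0, 0, 1), (1, 1, 0), (2, 1, 1)}"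
      using that by (auto simp: less_2_cases_iff) presburger+
    ultimately show ?thesis by (simp only: \<psi>_idx)
  qed
  have C: "neg_AB_C dA 2 2 \<psi> = sqrt 2 / 3"
    unfolding neg_AB_C_def
  \<comment> \<open>Only 110 has c = 0, at AB index 3; 001 and 211 have AB indices 0 and 5.\<close>
  proof (rule negativity_three_terms[OF \<psi>, of 3 0 5 0])
    fix x y :: nat assume xy: "x < dA * 2" "y < 2"
    then have "x * 2 + y < dA * 2 * 2" by presburger
    moreover have "x * 2 + y \<in> {1, 6, 11} \<longleftrightarrow> (if y = 0 then x = 3 else x = 0 \<or> x = 5)"
      using xy by (auto simp: less_2_cases_iff) presburger+
    ultimately show "\<psi> $ (x * 2 + y) = (if y = 0 then (if x = 3 then 1 / sqrt 3 else 0)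
        else (if x = 0 \<or> x = 5 then 1 / sqrt 3 else 0))"
      by (simp add: \<psi>_idx)
  qed (use dA in auto)
  have B: "neg_AC_B dA 2 2 \<psi> = sqrt 2 / 3"
    unfolding neg_AC_B_def \<phi>_def[symmetric]
  \<comment> \<open>Only 001 has b = 0, at AC index 1; 110 and 211 have AC indices 2 and 5.\<close>
  proof (rule negativity_three_terms[OF \<phi>(1), of 1 2 5 0])
    fix x y :: nat assume xy: "x < dA * 2" "y < 2"
    define a c where "a = x div 2" and "c = x mod 2"
    have x: "x = a * 2 + c" and ac: "a < dA" "c < 2" using xy by (auto simp: a_def c_def)
    show "\<phi> $ (x * 2 + y) = (if y = 0 then (if x = 1 then 1 / sqrt 3 else 0)
        else (if x = 2 \<or> x = 5 then 1 / sqrt 3 else 0))"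
      unfolding x \<phi>_idx[OF ac(1) xy(2) ac(2)] using ac xy(2)
      by (auto simp: less_2_cases_iff) presburger
  qed (use dA in auto)
  \<comment> \<open>\<sigma> lists the CB indices c * 2 + b that accompany a = 0, 1, 2. They are
    distinct, so the state is already in Schmidt form with three equal coefficients.\<close>
  define \<sigma> where "\<sigma> k = [2, 1, 3 :: nat] ! k" for k
  have "schmidt dA (2 * 2) (\<lambda>x y. \<phi> $ (x * (2 * 2) + y)) 3 (\<lambda>_. 1 / sqrt 3)
      (\<lambda>k i. if i = k then 1 else 0) (\<lambda>k i. if i = \<sigma> k then 1 else 0)"
    unfolding schmidt_def
  proof (intro conjI allI impI)
    show "orthonormal dA {..<3} (\<lambda>k i. if i = k then 1 else 0)"
      using orthonormal_delta[of "\<lambda>k. k" "{..<3}" dA] dA by auto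
    show "orthonormal (2 * 2) {..<3} (\<lambda>k i. if i = \<sigma> k then 1 else 0)"
      by (rule orthonormal_delta) (auto simp: \<sigma>_def inj_on_def numeral_3_eq_3 less_Suc_eq)
    fix x y :: nat assume x: "x < dA" and y: "y < 2 * 2"
    define c b where "c = y div 2" and "b = y mod 2"
    have y': "y = c * 2 + b" and cb: "c < 2" "b < 2" using y by (auto simp: b_def c_def)
    have "x * (2 * 2) + y = (x * 2 + c) * 2 + b" by (simp add: y')
    then show "\<phi> $ (x * (2 * 2) + y) = (\<Sum>k<3. complex_of_real (1 / sqrt 3)
        * (if x = k then 1 else 0) * (if y = \<sigma> k then 1 else 0))"
      using cb by (simp only: \<phi>_idx[OF x cb(2) cb(1)])
        (auto simp: y' \<sigma>_def numeral_3_eq_3 less_2_cases_iff)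
  qed simp
  from negativity_schmidt[OF \<phi>(2) this] have A: "neg_A_CB dA 2 2 \<psi> = 1"
    by (simp add: neg_A_CB_def \<phi>_def power_divide)
  have "sqrt 2 < 3 / 2" by (rule real_less_lsqrt) (auto simp: power2_eq_square)
  then show "neg_AC_B dA 2 2 \<psi> + neg_AB_C dA 2 2 \<psi> < neg_A_CB dA 2 2 \<psi>"
    by (simp add: A B C)
qed

theorem theorem1:
  fixes dA :: nat
  assumes "dA \<ge> 2"
  shows "(\<forall>dB dC. dB \<ge> 1 \<longrightarrow> dC \<ge> 1 \<longrightarrow>
            (\<forall>\<psi> \<in> carrier_vec (dA * dB * dC). unit_vec_c \<psi> \<longrightarrow>
               neg_A_CB dA dB dC \<psi> \<le> neg_AC_B dA dB dC \<psi> + neg_AB_C dA dB dC \<psi>))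
         \<longleftrightarrow> dA = 2" (is "?L \<longleftrightarrow> _")
proof
  assume L: ?L
  show "dA = 2"
  proof (rule ccontr)
    assume "dA \<noteq> 2"
    with assms have "dA \<ge> 3" by simp
    from negativity_qutrit_counterexample[OF this] L[rule_format, of 2 2] show False
      by (metis not_le one_le_numeral vec_carrier)
  qed
next
  assume "dA = 2"
  then show ?L using negativity_qubit_le by blast
qed

end
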